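(* Let $n\ge 2$ and let $T_n$ be a random recursive tree on $[n]$. Let $T_n^{root}$ be the tree obtained after a degree-biased cut of $T_n$. For every $\ell\in\{1,\dots,n-2\}$, conditionally given that $|T_n^{root}|=\ell$, the relabeled tree $\Phi(T_n^{root})$ has the distribution of a random recursive tree of size $\ell$ (that is, it is uniformly distributed on $I_\ell$).
   Context: An increasing tree on $[n]=\{1,\dots,n\}$ is a rooted labeled tree with vertex set $[n]$ in which labels along any path away from the root increase (so the root is $1$). $I_n$ is the set of increasing trees on $[n]$; a random recursive tree $T_n$ of size $n$ is a uniformly random element of $I_n$. $|t|$ denotes the number of vertices of $t$. An edge is written $v_1v_2$ with $v_1<v_2$ (so $v_1$ is the parent of $v_2$). For a vertex $v$ of a tree $t$, $t^{(v)}$ is the subtree rooted at $v$, consisting of $v$ and all its descendants. Degree-biased cut: given an increasing tree $t$ with at least two vertices, choose an edge $v_1v_2$ of $t$ uniformly at random. If $v_1>1$, let $v_0$ be the parent of $v_1$ and set $t^{root}:=t\setminus(t^{(v_1)}\cup v_0v_1)$, the subtree containing the root after deleting $t^{(v_1)}$ and the edge $v_0v_1$. If $v_1=1$ is the root, set $t^{root}:=\emptyset$. Relabeling: for a tree $t'$ with vertex set $\{v_1<\dots<v_m\}$, $\Phi(t')$ is the tree on $[m]$ obtained by relabeling each $v_i$ with $i$. *)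

theory Defs
  imports "HOL-Probability.Probability" "Graph_Theory.Graph_Theory"
begin

section \<open>Rooted and increasing trees\<close>

text \<open>
  A tree is a \<^typ>\<open>nat pair_pre_digraph\<close> whose arcs \<open>(v\<^sub>1, v\<^sub>2)\<close> are the edges oriented away from
  the root, so \<open>v\<^sub>1\<close> is the parent of \<open>v\<^sub>2\<close>. (\<^const>\<open>Digraph_Component.tree\<close> does not fit: its cycles
  are directed, so it admits graphs with undirected cycles.)

  Uniqueness is required among all walks from the root, not only among the paths (\<open>apath\<close>), since
  arcs leading back to an ancestor lie on no path from the root.
\<close>

definition rooted_tree :: "'a pair_pre_digraph \<Rightarrow> 'a \<Rightarrow> bool" where
  "rooted_tree t r \<longleftrightarrow> pair_wf_digraph t \<and> r \<in> pverts t \<and>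
     (\<forall>v\<in>pverts t. \<exists>!p. pre_digraph.awalk (with_proj t) r p v)"

definition increasing_trees :: "nat \<Rightarrow> nat pair_pre_digraph set" where
  "increasing_trees n = {t. pverts t = {1..n} \<and> (\<exists>r. rooted_tree t r) \<and>
     (\<forall>u p v. pre_digraph.apath (with_proj t) u p v \<longrightarrow>
        sorted_wrt (<) (pre_digraph.awalk_verts (with_proj t) u p))}"

definition tree_size :: "'a pair_pre_digraph \<Rightarrow> nat" where
  "tree_size t = card (pverts t)"

lemma finite_increasing_trees: "finite (increasing_trees n)"
proof -
  have "increasing_trees n \<subseteq>
      (\<lambda>E. \<lparr>pverts = {1..n}, parcs = E\<rparr>) ` Pow ({1..n} \<times> {1..n})"
  proof
    fix t assume "t \<in> increasing_trees n"
    then have "pverts t = {1..n}" "pair_wf_digraph t"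
      by (auto simp: increasing_trees_def rooted_tree_def)
    then have "parcs t \<subseteq> {1..n} \<times> {1..n}" "t = \<lparr>pverts = {1..n}, parcs = parcs t\<rparr>"
      by (auto dest: pair_wf_digraph.in_arcsD1 pair_wf_digraph.in_arcsD2)
    then show "t \<in> (\<lambda>E. \<lparr>pverts = {1..n}, parcs = E\<rparr>) ` Pow ({1..n} \<times> {1..n})"
      by blast
  qed
  then show ?thesis
    by (rule finite_subset) auto
qed

lemma increasing_trees_nonempty:
  assumes "n \<ge> 1"
  shows "increasing_trees n \<noteq> {}"
proof -
  define t :: "nat pair_pre_digraph" where "t = \<lparr>pverts = {1..n}, parcs = {1} \<times> {2..n}\<rparr>"
  have t: "pverts t = {1..n}" "parcs t = {1} \<times> {2..n}"
    by (simp_all add: t_def)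
  have wf: "pair_wf_digraph t"
    by unfold_locales (auto simp: t)
  interpret pair_wf_digraph t by (rule wf)
  have walk: "p = (if u = v then [] else [(u, v)]) \<and> (u = v \<or> u < v)"
    if "awalk u p v" for u p v
  proof (cases p)
    case (Cons e es)
    with that show ?thesis
      by (cases es) (auto simp: awalk_simps t)
  qed (use that in \<open>auto simp: awalk_simps\<close>)
  have "rooted_tree t 1"
    unfolding rooted_tree_def
  proof (intro conjI ballI wf)
    fix v assume "v \<in> pverts t"
    then have "awalk 1 (if 1 = v then [] else [(1, v)]) v"
      by (auto simp: awalk_simps t)
    then show "\<exists>!p. awalk 1 p v"
      using walk by blast
  qed (use assms t in auto)
  moreover have "sorted_wrt (<) (awalk_verts u p)" if "apath u p v" for u p v
    using walk[OF awalkI_apath[OF that]] by (auto split: if_splits)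
  ultimately have "t \<in> increasing_trees n"
    unfolding increasing_trees_def awalk_verts_with_proj_eq using t by blast
  then show ?thesis by blast
qed

definition random_recursive_tree :: "nat \<Rightarrow> nat pair_pre_digraph pmf" where
  "random_recursive_tree n = pmf_of_set (increasing_trees n)"

section \<open>Degree-biased cut\<close>

definition subtree_at :: "'a pair_pre_digraph \<Rightarrow> 'a \<Rightarrow> 'a pair_pre_digraph" where
  "subtree_at t v = (let D = {w. v \<rightarrow>\<^sup>*\<^bsub>with_proj t\<^esub> w} in
     \<lparr>pverts = D, parcs = {(x, y) \<in> parcs t. x \<in> D \<and> y \<in> D}\<rparr>)"

definition parent :: "'a pair_pre_digraph \<Rightarrow> 'a \<Rightarrow> 'a" where
  "parent t v = (THE u. (u, v) \<in> parcs t)"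

text \<open>The tree \<open>t\<^sup>r\<^sup>o\<^sup>o\<^sup>t\<close> when the chosen edge has upper endpoint \<open>v\<^sub>1\<close>.\<close>

definition root_part :: "nat pair_pre_digraph \<Rightarrow> nat \<Rightarrow> nat pair_pre_digraph" where
  "root_part t v\<^sub>1 =
     (if v\<^sub>1 = 1 then \<lparr>pverts = {}, parcs = {}\<rparr>
      else \<lparr>pverts = pverts t - pverts (subtree_at t v\<^sub>1),
            parcs = parcs t - (parcs (subtree_at t v\<^sub>1) \<union> {(parent t v\<^sub>1, v\<^sub>1)})\<rparr>)"

definition degree_biased_cut :: "nat pair_pre_digraph \<Rightarrow> nat pair_pre_digraph pmf" where
  "degree_biased_cut t = map_pmf (\<lambda>(v\<^sub>1, v\<^sub>2). root_part t v\<^sub>1) (pmf_of_set (parcs t))"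

definition random_root_tree :: "nat \<Rightarrow> nat pair_pre_digraph pmf" where
  "random_root_tree n = bind_pmf (random_recursive_tree n) degree_biased_cut"

section \<open>Relabeling\<close>

text \<open>The \<open>i\<close>-th smallest vertex \<open>v\<close> has exactly \<open>i\<close> vertices \<open>w \<le> v\<close>.\<close>

definition relabel :: "nat pair_pre_digraph \<Rightarrow> nat pair_pre_digraph" where
  "relabel t = (let rank = (\<lambda>v. card {w \<in> pverts t. w \<le> v}) in
     \<lparr>pverts = rank ` pverts t, parcs = map_prod rank rank ` parcs t\<rparr>)"

end

theory Submission
  imports Defs
begin

text \<open>
  The root part can be exchanged without disturbing anything else. Cut an increasing tree \<open>t\<close> on
  \<open>{1..n}\<close> at the upper endpoint \<open>v \<noteq> 1\<close> of an edge, and let \<open>D\<close> be the set of descendants of \<open>v\<close>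
  and \<open>V = {1..n} - D\<close> the vertex set of the root part. Given any increasing tree \<open>s\<close> with \<open>card V\<close>
  vertices, put a copy of \<open>s\<close> on \<open>V\<close> by the order isomorphism and keep every edge of \<open>t\<close> whose lower
  endpoint lies in \<open>D\<close>, including the one that attaches \<open>v\<close> to its parent in \<open>V\<close>
  (\<open>graft_root\<close>). An increasing tree is the same as a choice of a smaller parent for each vertex but
  the least, so the result is again an increasing tree on \<open>{1..n}\<close>. It has the same descendants of
  \<open>v\<close> and contains the same cut edge, and cutting it there gives a root part that relabels to \<open>s\<close>.

  Grafting the original root part back recovers \<open>t\<close>. Hence, among the pairs of a tree and an edge whose
  root part has \<open>l\<close> vertices, those that yield \<open>s\<close> inject into those that yield \<open>s'\<close>, for any
  \<open>s\<close> and \<open>s'\<close>, and all fibres have the same size (\<open>card_fibre_le\<close>). Every increasing tree on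
  \<open>{1..n}\<close> has \<open>n - 1\<close> edges, so tree and cut edge together are uniformly distributed over all such pairs.
  Conditioning on the size of the root part keeps that distribution uniform, and its image under a map
  with equally large fibres is uniform as well.
\<close>

section \<open>Uniform distributions on finite sets\<close>

lemma cond_pmf_of_set:
  assumes "finite S" "S \<inter> A \<noteq> {}"
  shows "cond_pmf (pmf_of_set S) A = pmf_of_set (S \<inter> A)"
proof (rule pmf_eqI)
  fix x
  have S: "S \<noteq> {}" and pos: "card (S \<inter> A) > 0" "card S > 0"
    using assms by (auto simp: card_gt_0_iff)
  have "set_pmf (pmf_of_set S) \<inter> A \<noteq> {}"
    using assms S by simp
  then show "pmf (cond_pmf (pmf_of_set S) A) x = pmf (pmf_of_set (S \<inter> A)) x"
    using assms S pos by (auto simp: pmf_cond measure_pmf_of_set indicator_def)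
qed

text \<open>The number of options at the second stage does not depend on the outcome of the first, so every
  pair has the same weight.\<close>

lemma bind_pmf_of_set_Sigma:
  assumes "finite A" "A \<noteq> {}" and card: "\<And>a. a \<in> A \<Longrightarrow> card (B a) = k" and "k > 0"
  shows "bind_pmf (pmf_of_set A) (\<lambda>a. map_pmf (f a) (pmf_of_set (B a))) =
    map_pmf (\<lambda>(a, b). f a b) (pmf_of_set (Sigma A B))"
proof -
  have B: "finite (B a) \<and> B a \<noteq> {}" if "a \<in> A" for a
    using card[OF that] \<open>k > 0\<close> by (metis card.empty card.infinite less_irrefl)
  have S: "finite (Sigma A B)" "Sigma A B \<noteq> {}"
    using assms B by auto
  have cardS: "card (Sigma A B) = card A * k"
    using assms B by (simp add: card_SigmaI)
  have "bind_pmf (pmf_of_set A) (\<lambda>a. map_pmf (Pair a) (pmf_of_set (B a))) = pmf_of_set (Sigma A B)"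
  proof (rule pmf_eqI)
    fix x :: "'a \<times> 'b"
    obtain a b where x: "x = (a, b)" by force
    have "pmf (bind_pmf (pmf_of_set A) (\<lambda>a. map_pmf (Pair a) (pmf_of_set (B a)))) x =
        (\<Sum>c\<in>A. pmf (map_pmf (Pair c) (pmf_of_set (B c))) x) / card A"
      using assms by (simp add: pmf_bind integral_pmf_of_set)
    also have "(\<Sum>c\<in>A. pmf (map_pmf (Pair c) (pmf_of_set (B c))) x) =
        (\<Sum>c\<in>A. if c = a then indicator (B a) b / k else 0)"
    proof (rule sum.cong)
      fix c assume "c \<in> A"
      have "pmf (map_pmf (Pair c) (pmf_of_set (B c))) x = card (B c \<inter> Pair c -` {x}) / k"
        using B[OF \<open>c \<in> A\<close>] card[OF \<open>c \<in> A\<close>] by (simp add: pmf_map measure_pmf_of_set)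
      also have "B c \<inter> Pair c -` {x} = (if c = a then B a \<inter> {b} else {})"
        by (auto simp: x)
      finally show "pmf (map_pmf (Pair c) (pmf_of_set (B c))) x =
          (if c = a then indicator (B a) b / k else 0)"
        by (auto simp: indicator_def)
    qed simp
    also have "\<dots> = (if a \<in> A then indicator (B a) b / k else 0)"
      using assms by simp
    also have "\<dots> / card A = pmf (pmf_of_set (Sigma A B)) x"
      using S cardS by (auto simp: x indicator_def)
    finally show "pmf (bind_pmf (pmf_of_set A) (\<lambda>a. map_pmf (Pair a) (pmf_of_set (B a)))) x =
        pmf (pmf_of_set (Sigma A B)) x" .
  qed
  from arg_cong[OF this, of "map_pmf (\<lambda>(a, b). f a b)"] show ?thesis
    by (simp add: map_bind_pmf pmf.map_comp o_def)
qed

lemma map_pmf_of_set_equal_fibres: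
  assumes "finite S" "S \<noteq> {}" "finite T" and maps: "g ` S \<subseteq> T"
    and fibres: "\<And>s. s \<in> T \<Longrightarrow> card {x \<in> S. g x = s} = c"
  shows "map_pmf g (pmf_of_set S) = pmf_of_set T"
proof (rule pmf_eqI)
  fix s
  have T: "T \<noteq> {}" using assms by auto
  have "S = (\<Union>s\<in>T. {x \<in> S. g x = s})" using maps by auto
  then have "card S = card (\<Union>s\<in>T. {x \<in> S. g x = s})" by simp
  also have "\<dots> = (\<Sum>s\<in>T. card {x \<in> S. g x = s})"
    using assms by (subst card_UN_disjoint) auto
  also have "\<dots> = card T * c" using fibres by simp
  finally have cardS: "card S = card T * c" .
  then have c: "c > 0" using assms by (metis card_gt_0_iff nat_0_less_mult_iff)
  have eq: "S \<inter> g -` {s} = {x \<in> S. g x = s}" by auto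
  have "s \<notin> T \<Longrightarrow> {x \<in> S. g x = s} = {}" using maps by auto
  then have "card {x \<in> S. g x = s} = (if s \<in> T then c else 0)"
    using fibres by (metis card.empty)
  then show "pmf (map_pmf g (pmf_of_set S)) s = pmf (pmf_of_set T) s"
    using assms T cardS c by (simp add: pmf_map measure_pmf_of_set eq)
qed

section \<open>Increasing trees as parent assignments\<close>

text \<open>The existence of a smaller vertex singles out the vertices other than the least one. Unlike a
  comparison with the minimum, it makes sense for every set \<open>V\<close> and is visibly invariant under order
  isomorphisms.\<close>

definition increasing_arcs :: "nat set \<Rightarrow> (nat \<times> nat) set \<Rightarrow> bool" where
  "increasing_arcs V E \<longleftrightarrow> (\<forall>(u, v)\<in>E. u \<in> V \<and> v \<in> V \<and> u < v) \<and>
     (\<forall>v\<in>V. (\<exists>w\<in>V. w < v) \<longrightarrow> (\<exists>!u. (u, v) \<in> E))"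

lemma increasing_arcsD:
  assumes "increasing_arcs V E" "(u, v) \<in> E"
  shows "u \<in> V" "v \<in> V" "u < v"
  using assms by (auto simp: increasing_arcs_def)

lemma increasing_arcs_parent_unique:
  assumes "increasing_arcs V E" "(u, v) \<in> E" "(u', v) \<in> E"
  shows "u = u'"
proof -
  have "u \<in> V" "v \<in> V" "u < v" using increasing_arcsD[OF assms(1,2)] by auto
  then have "\<exists>!u. (u, v) \<in> E" using assms(1) unfolding increasing_arcs_def by blast
  then show ?thesis using assms by blast
qed

lemma (in pair_wf_digraph) awalk_snoc_iff:
  "awalk u (p @ [e]) v \<longleftrightarrow> awalk u p (fst e) \<and> e \<in> parcs G \<and> snd e = v"
proof -
  have "pcas u (p @ [e]) v \<longleftrightarrow> pcas u p (fst e) \<and> snd e = v"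
    by (induction p arbitrary: u) auto
  then show ?thesis by (auto simp: awalk_def simp del: awalk_append_iff)
qed

text \<open>Two arcs into the same vertex, or a loop, would give two walks from the root to one vertex. A single
  arc is a path, so it increases. The last arc of the walk to a vertex other than the root supplies its
  parent, and the vertex \<open>1\<close>, which no increasing arc can enter, must be the root.\<close>

lemma increasing_arcs_if_increasing_tree:
  assumes t: "t \<in> increasing_trees n"
  shows "increasing_arcs {1..n} (parcs t)"
proof -
  obtain r where verts: "pverts t = {1..n}" and wf: "pair_wf_digraph t" and r: "r \<in> {1..n}"
    and ex1: "\<And>v. v \<in> {1..n} \<Longrightarrow> \<exists>!p. pre_digraph.awalk (with_proj t) r p v"
    and sorted: "\<And>u p v. pre_digraph.apath (with_proj t) u p v \<Longrightarrow>
      sorted_wrt (<) (pre_digraph.awalk_verts (with_proj t) u p)"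
    using t unfolding increasing_trees_def rooted_tree_def mem_Collect_eq by metis
  interpret pair_wf_digraph t by (rule wf)
  have in_verts: "u \<in> {1..n} \<and> v \<in> {1..n}" if "(u, v) \<in> parcs t" for u v
    using that verts in_arcsD1 in_arcsD2 by blast
  have walk_unique: "p = q" if "awalk r p v" "awalk r q v" for p q v
    using that ex1[of v] awalk_last_in_verts[OF that(1)] verts by auto
  have parent_unique: "u = u'"
    if e: "(u, v) \<in> parcs t" and e': "(u', v) \<in> parcs t" for u u' v
  proof -
    obtain p where "awalk r p u" using in_verts[OF e] ex1 by blast
    moreover obtain p' where "awalk r p' u'" using in_verts[OF e'] ex1 by blast
    ultimately have "awalk r (p @ [(u, v)]) v" "awalk r (p' @ [(u', v)]) v"
      using e e' by (simp_all add: awalk_snoc_iff del: awalk_append_iff)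
    then have "p @ [(u, v)] = p' @ [(u', v)]" by (rule walk_unique)
    then show ?thesis by simp
  qed
  have less: "u < v" if e: "(u, v) \<in> parcs t" for u v
  proof -
    have "u \<noteq> v"
    proof
      assume "u = v"
      obtain p where "awalk r p u" using e in_verts ex1 by blast
      moreover from this have "awalk r (p @ [(u, v)]) u"
        using e \<open>u = v\<close> by (auto simp: awalk_snoc_iff simp del: awalk_append_iff)
      ultimately show False using walk_unique by blast
    qed
    then have "apath u [(u, v)] v"
      using e in_verts verts by (auto simp: apath_def awalk_simps)
    from sorted[OF this] show ?thesis by simp
  qed
  have parent_exists: "\<exists>u. (u, v) \<in> parcs t" if v: "v \<in> {1..n}" "v \<noteq> r" for v
  proof -
    obtain p where p: "awalk r p v" using ex1 v by blast
    then have "p \<noteq> []" using v by (auto simp: awalk_simps)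
    then obtain q e where "p = q @ [e]" by (metis rev_exhaust)
    then have "e \<in> parcs t" "snd e = v" using p by (auto simp: awalk_snoc_iff simp del: awalk_append_iff)
    then show ?thesis by (metis prod.collapse)
  qed
  have "r = 1"
  proof (rule ccontr)
    assume "r \<noteq> 1"
    then obtain u where "(u, 1) \<in> parcs t" using parent_exists[of 1] r by auto
    then show False using less in_verts by fastforce
  qed
  then have "\<exists>!u. (u, v) \<in> parcs t" if "v \<in> {1..n}" "\<exists>w\<in>{1..n}. w < v" for v
    using that parent_exists[of v] parent_unique by auto
  then show ?thesis
    unfolding increasing_arcs_def using in_verts less by auto
qed

text \<open>Following parents upwards decreases the label and so ends at \<open>1\<close>; as every step is forced, this gives
  the only walk from \<open>1\<close>.\<close>

lemma increasing_tree_if_increasing_arcs: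
  assumes "n \<ge> 1" and E: "increasing_arcs {1..n} E"
  shows "\<lparr>pverts = {1..n}, parcs = E\<rparr> \<in> increasing_trees n"
proof -
  define t :: "nat pair_pre_digraph" where "t = \<lparr>pverts = {1..n}, parcs = E\<rparr>"
  have t: "pverts t = {1..n}" "parcs t = E" by (simp_all add: t_def)
  have wf: "pair_wf_digraph t"
    by unfold_locales (use increasing_arcsD(1,2)[OF E] in \<open>auto simp: t\<close>)
  interpret pair_wf_digraph t by (rule wf)
  have walk_le: "u \<le> v" if "awalk u p v" for u p v
    using that
  proof (induction p arbitrary: v rule: rev_induct)
    case (snoc e p)
    then have "u \<le> fst e" "(fst e, v) \<in> E" by (auto simp: awalk_snoc_iff t simp del: awalk_append_iff)
    then show ?case using increasing_arcsD(3)[OF E] by (meson less_imp_le order_trans)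
  qed (simp add: awalk_simps)
  have sorted: "sorted_wrt (<) (awalk_verts u p)" if "awalk u p v" for u p v
    using that
  proof (induction p arbitrary: u)
    case (Cons e p)
    then have e: "e \<in> E" "fst e = u" and p: "awalk (snd e) p v"
      by (auto simp: awalk_simps t)
    have "fst e < snd e"
      using increasing_arcsD(3)[OF E, of "fst e" "snd e"] e by (metis prod.collapse)
    moreover have "snd e \<le> w" if "w \<in> set (awalk_verts (snd e) p)" for w
      using awalk_decomp[OF p that] walk_le by metis
    ultimately have "\<forall>w\<in>set (awalk_verts (snd e) p). fst e < w"
      by (meson less_le_trans)
    then show ?case
      using Cons.IH[OF p] by simp
  qed simp
  have "rooted_tree t 1"
    unfolding rooted_tree_def
  proof (intro conjI ballI wf)
    show "1 \<in> pverts t" using assms t by auto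
    fix v assume "v \<in> pverts t"
    then show "\<exists>!p. awalk 1 p v"
    proof (induction v rule: less_induct)
      case (less v)
      show ?case
      proof (cases "v = 1")
        case True
        have "p = []" if "awalk 1 p 1" for p
        proof (cases p)
          case (Cons e q)
          then have "e \<in> E" "fst e = 1" "awalk (snd e) q 1"
            using that by (auto simp: awalk_simps t)
          then have e: "(1, snd e) \<in> E" and "awalk (snd e) q 1"
            by (metis prod.collapse)+
          then have "1 < snd e" "snd e \<le> 1"
            using increasing_arcsD(3)[OF E e] walk_le by simp_all
          then show ?thesis by simp
        qed
        moreover have "awalk 1 [] 1" using assms t by (auto simp: awalk_simps)
        ultimately have "\<exists>!p. awalk 1 p 1" by (rule ex1I[rotated])
        then show ?thesis using True by simp
      next
        case False
        have v: "v \<in> {1..n}" using less.prems by (simp add: t)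
        then have "1 \<in> {1..n}" "1 < v" using False by auto
        then have "\<exists>w\<in>{1..n}. w < v" by blast
        then have "\<exists>!u. (u, v) \<in> E" using E v by (simp add: increasing_arcs_def)
        then obtain u where u: "(u, v) \<in> E" by blast
        then have "u < v" "u \<in> pverts t" using increasing_arcsD[OF E u] by (simp_all add: t)
        then have "\<exists>!p. awalk 1 p u" by (rule less.IH)
        then obtain p where p: "awalk 1 p u" and p_unique: "\<And>q. awalk 1 q u \<Longrightarrow> q = p"
          by metis
        have "awalk 1 (p @ [(u, v)]) v" using p u by (simp add: awalk_snoc_iff t del: awalk_append_iff)
        moreover have "q = p @ [(u, v)]" if q: "awalk 1 q v" for q
        proof -
          have "q \<noteq> []" using q False by (auto simp: awalk_simps)
          then obtain q' e where q': "q = q' @ [e]" by (metis rev_exhaust)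
          have q'_walk: "awalk 1 q' (fst e)" and e: "e \<in> E" "snd e = v"
            using q by (simp_all add: q' awalk_snoc_iff t del: awalk_append_iff)
          have "(fst e, v) \<in> E" using e by auto
          then have "fst e = u" by (rule increasing_arcs_parent_unique[OF E _ u])
          then have "e = (u, v)" using e by auto
          moreover have "q' = p" using p_unique q'_walk \<open>fst e = u\<close> by simp
          ultimately show ?thesis using q' by simp
        qed
        ultimately show ?thesis by (rule ex1I)
      qed
    qed
  qed
  then have "t \<in> increasing_trees n"
    unfolding increasing_trees_def awalk_verts_with_proj_eq
    using t(1) sorted[OF awalkI_apath] by blast
  then show ?thesis by (simp add: t_def)
qed

lemma increasing_trees_iff:
  assumes "n \<ge> 1"
  shows "t \<in> increasing_trees n \<longleftrightarrow> pverts t = {1..n} \<and> increasing_arcs {1..n} (parcs t)"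
proof
  assume "t \<in> increasing_trees n"
  then show "pverts t = {1..n} \<and> increasing_arcs {1..n} (parcs t)"
    using increasing_arcs_if_increasing_tree by (auto simp: increasing_trees_def)
next
  assume *: "pverts t = {1..n} \<and> increasing_arcs {1..n} (parcs t)"
  then have "t = \<lparr>pverts = {1..n}, parcs = parcs t\<rparr>" by simp
  then show "t \<in> increasing_trees n"
    using increasing_tree_if_increasing_arcs[OF assms] * by metis
qed

text \<open>Each vertex but the root is the lower endpoint of exactly one edge.\<close>

lemma card_parcs_increasing_tree:
  assumes "n \<ge> 1" "t \<in> increasing_trees n"
  shows "card (parcs t) = n - 1"
proof -
  have E: "increasing_arcs {1..n} (parcs t)"
    using assms by (simp add: increasing_trees_iff)
  have "bij_betw snd (parcs t) {2..n}"
    unfolding bij_betw_def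
  proof
    show "inj_on snd (parcs t)"
      using increasing_arcs_parent_unique[OF E] by (metis inj_onI prod.collapse)
    show "snd ` parcs t = {2..n}"
    proof (intro equalityI subsetI)
      fix v assume "v \<in> snd ` parcs t"
      then obtain u where "(u, v) \<in> parcs t" by auto
      from increasing_arcsD[OF E this] show "v \<in> {2..n}" by auto
    next
      fix v assume v: "v \<in> {2..n}"
      then have "\<exists>w\<in>{1..n}. w < v" "v \<in> {1..n}" by (auto intro!: bexI[of _ 1])
      then obtain u where "(u, v) \<in> parcs t" using E unfolding increasing_arcs_def by blast
      then show "v \<in> snd ` parcs t" by force
    qed
  qed
  then show ?thesis using bij_betw_same_card by fastforce
qed

section \<open>Relabeling by ranks\<close>

definition rank_in :: "nat set \<Rightarrow> nat \<Rightarrow> nat" where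
  "rank_in V v = card {w \<in> V. w \<le> v}"

lemma relabel_eq:
  "relabel t = \<lparr>pverts = rank_in (pverts t) ` pverts t,
     parcs = map_prod (rank_in (pverts t)) (rank_in (pverts t)) ` parcs t\<rparr>"
  by (simp add: relabel_def rank_in_def[abs_def] Let_def)

lemma rank_in_less_iff:
  assumes "finite V" "u \<in> V" "v \<in> V"
  shows "rank_in V u < rank_in V v \<longleftrightarrow> u < v"
proof -
  have less: "rank_in V a < rank_in V b" if "a < b" "b \<in> V" for a b
  proof -
    have "b \<in> {w \<in> V. w \<le> b}" "b \<notin> {w \<in> V. w \<le> a}" using that by auto
    moreover have "{w \<in> V. w \<le> a} \<subseteq> {w \<in> V. w \<le> b}" using that by auto
    ultimately show ?thesis
      unfolding rank_in_def using assms by (intro psubset_card_mono) auto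
  qed
  show ?thesis
    using less[of u v] less[of v u] assms by (metis less_asym linorder_neqE_nat less_irrefl)
qed

lemma bij_betw_rank_in:
  assumes "finite V"
  shows "bij_betw (rank_in V) V {1..card V}"
proof -
  have inj: "inj_on (rank_in V) V"
    by (rule inj_onI) (metis assms linorder_neqE_nat less_irrefl rank_in_less_iff)
  have "rank_in V ` V \<subseteq> {1..card V}"
  proof
    fix i assume "i \<in> rank_in V ` V"
    then obtain v where v: "v \<in> V" "i = rank_in V v" by auto
    then have "card {w \<in> V. w \<le> v} > 0" using assms by (auto simp: card_gt_0_iff)
    moreover have "card {w \<in> V. w \<le> v} \<le> card V" using assms by (intro card_mono) auto
    ultimately show "i \<in> {1..card V}" using v by (simp add: rank_in_def)
  qed
  then have "rank_in V ` V = {1..card V}"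
    using card_image[OF inj] by (intro card_subset_eq) auto
  then show ?thesis using inj by (simp add: bij_betw_def)
qed

definition pullback_arcs :: "('a \<Rightarrow> 'b) \<Rightarrow> 'a set \<Rightarrow> ('b \<times> 'b) set \<Rightarrow> ('a \<times> 'a) set" where
  "pullback_arcs r V F = {(x, y) \<in> V \<times> V. (r x, r y) \<in> F}"

lemma map_prod_pullback_arcs:
  assumes "F \<subseteq> r ` V \<times> r ` V"
  shows "map_prod r r ` pullback_arcs r V F = F"
proof (intro equalityI subsetI)
  fix e assume "e \<in> F"
  moreover from this obtain x y where "e = (r x, r y)" "x \<in> V" "y \<in> V" using assms by blast
  ultimately show "e \<in> map_prod r r ` pullback_arcs r V F"
    by (force simp: pullback_arcs_def)
qed (auto simp: pullback_arcs_def)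

lemma pullback_arcs_map_prod:
  assumes "inj_on r V" "E \<subseteq> V \<times> V"
  shows "pullback_arcs r V (map_prod r r ` E) = E"
  using assms by (auto simp: pullback_arcs_def dest: inj_onD)

lemma increasing_arcs_pullback:
  assumes bij: "bij_betw r V W"
    and mono: "\<And>u v. u \<in> V \<Longrightarrow> v \<in> V \<Longrightarrow> r u < r v \<longleftrightarrow> u < v"
    and F: "increasing_arcs W F"
  shows "increasing_arcs V (pullback_arcs r V F)"
proof -
  have "\<exists>!u. (u, v) \<in> pullback_arcs r V F" if v: "v \<in> V" "\<exists>w\<in>V. w < v" for v
  proof -
    have "r v \<in> W" "\<exists>w\<in>W. w < r v" using v bij mono by (auto simp: bij_betw_def)
    then obtain x where x: "(x, r v) \<in> F" using F unfolding increasing_arcs_def by blast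
    then obtain u where u: "u \<in> V" "x = r u"
      using increasing_arcsD(1)[OF F x] bij by (auto simp: bij_betw_def)
    have "u' = u" if "(u', v) \<in> pullback_arcs r V F" for u'
      using that u x increasing_arcs_parent_unique[OF F x, of "r u'"] bij
      by (auto simp: pullback_arcs_def bij_betw_def inj_on_def)
    moreover have "(u, v) \<in> pullback_arcs r V F" using u v x by (simp add: pullback_arcs_def)
    ultimately show ?thesis by blast
  qed
  moreover have "u \<in> V \<and> v \<in> V \<and> u < v" if "(u, v) \<in> pullback_arcs r V F" for u v
    using that mono[of u v] increasing_arcsD(3)[OF F, of "r u" "r v"]
    by (simp add: pullback_arcs_def)
  ultimately show ?thesis
    unfolding increasing_arcs_def by blast
qed

lemma increasing_arcs_image:
  assumes bij: "bij_betw r V W"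
    and mono: "\<And>u v. u \<in> V \<Longrightarrow> v \<in> V \<Longrightarrow> r u < r v \<longleftrightarrow> u < v"
    and E: "increasing_arcs V E"
  shows "increasing_arcs W (map_prod r r ` E)"
proof -
  \<comment> \<open>The image along \<open>r\<close> is the pullback along its inverse.\<close>
  define q where "q = the_inv_into V r"
  have q: "bij_betw q W V" using bij by (simp add: q_def bij_betw_the_inv_into)
  have rq: "r (q w) = w" if "w \<in> W" for w
    using that bij by (simp add: q_def f_the_inv_into_f_bij_betw)
  have W: "r ` V = W" "q ` W = V" using bij q by (auto simp: bij_betw_def)
  have qr: "q (r x) = x" if "x \<in> V" for x
    using that bij by (simp add: q_def the_inv_into_f_f bij_betw_def)
  have "map_prod r r ` E = pullback_arcs q W E"
  proof (intro equalityI subsetI)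
    fix e assume "e \<in> map_prod r r ` E"
    then obtain x y where "(x, y) \<in> E" "e = (r x, r y)" by auto
    then show "e \<in> pullback_arcs q W E"
      using increasing_arcsD[OF E] W qr by (auto simp: pullback_arcs_def)
  next
    fix e assume "e \<in> pullback_arcs q W E"
    then have "(q (fst e), q (snd e)) \<in> E" "fst e \<in> W" "snd e \<in> W"
      by (auto simp: pullback_arcs_def)
    moreover from this have "e = map_prod r r (q (fst e), q (snd e))" by (simp add: rq)
    ultimately show "e \<in> map_prod r r ` E" by blast
  qed
  moreover have "increasing_arcs W (pullback_arcs q W E)"
  proof (rule increasing_arcs_pullback[OF q _ E])
    fix u v assume "u \<in> W" "v \<in> W"
    then show "q u < q v \<longleftrightarrow> u < v" using mono[of "q u" "q v"] rq W by auto
  qed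
  ultimately show ?thesis by simp
qed

section \<open>Cutting and grafting\<close>

definition descendants :: "nat pair_pre_digraph \<Rightarrow> nat \<Rightarrow> nat set" where
  "descendants t v = (parcs t)\<^sup>* `` {v}"

lemma pverts_subtree_at:
  assumes "pair_wf_digraph t" "v \<in> pverts t"
  shows "pverts (subtree_at t v) = descendants t v"
proof -
  interpret pair_wf_digraph t by fact
  have "v \<rightarrow>\<^sup>*\<^bsub>with_proj t\<^esub> w \<longleftrightarrow> (v, w) \<in> (parcs t)\<^sup>*" for w
  proof
    assume "v \<rightarrow>\<^sup>*\<^bsub>with_proj t\<^esub> w"
    then show "(v, w) \<in> (parcs t)\<^sup>*"
      unfolding reachable_def with_proj_simps by (rule rtrancl_on_rtranclI)
  next
    assume "(v, w) \<in> (parcs t)\<^sup>*"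
    then show "v \<rightarrow>\<^sup>*\<^bsub>with_proj t\<^esub> w"
    proof induction
      case (step y z)
      then show ?case using reachable_adj_trans[OF step.IH step.hyps(2)] by simp
    qed (use assms in simp)
  qed
  then show ?thesis by (auto simp: subtree_at_def descendants_def Let_def)
qed

lemma self_in_descendants: "v \<in> descendants t v"
  by (simp add: descendants_def)

lemma child_in_descendants:
  "x \<in> descendants t v \<Longrightarrow> (x, y) \<in> parcs t \<Longrightarrow> y \<in> descendants t v"
  by (auto simp: descendants_def intro: rtrancl.rtrancl_into_rtrancl)

lemma descendants_parent:
  assumes "increasing_arcs V (parcs t)" "(x, y) \<in> parcs t" "y \<in> descendants t v" "y \<noteq> v"
  shows "x \<in> descendants t v"
proof -
  from assms(3) have "(v, y) \<in> (parcs t)\<^sup>*" by (simp add: descendants_def)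
  with assms(4) obtain z where z: "(v, z) \<in> (parcs t)\<^sup>*" "(z, y) \<in> parcs t"
    by (metis rtranclE)
  then have "z = x" using increasing_arcs_parent_unique assms(1,2) by blast
  then show ?thesis using z by (simp add: descendants_def)
qed

lemma descendants_ge:
  assumes "increasing_arcs V (parcs t)" "w \<in> descendants t v"
  shows "v \<le> w"
proof -
  have "(v, w) \<in> (parcs t)\<^sup>*" using assms by (simp add: descendants_def)
  then show ?thesis
  proof induction
    case (step y z)
    then show ?case using increasing_arcsD(3)[OF assms(1), of y z] by simp
  qed simp
qed

lemma parent_eq:
  assumes "increasing_arcs V (parcs t)" "(u, v) \<in> parcs t"
  shows "parent t v = u"
  unfolding parent_def using assms increasing_arcs_parent_unique by blast

text \<open>The removed edge is the only one that joins \<open>V\<close> to the descendants of \<open>v\<close>: any descendant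
  other than \<open>v\<close> has its unique parent among the descendants. So the root part is an induced
  subgraph.\<close>

lemma root_part_eq:
  assumes "n \<ge> 1" "t \<in> increasing_trees n" "v \<in> {1..n}" "v \<noteq> 1"
  defines "V \<equiv> {1..n} - descendants t v"
  shows "root_part t v = \<lparr>pverts = V, parcs = parcs t \<inter> V \<times> V\<rparr>"
proof -
  have t: "pverts t = {1..n}" and E: "increasing_arcs {1..n} (parcs t)"
    using assms by (auto simp: increasing_trees_iff)
  have wf: "pair_wf_digraph t"
    using assms by (auto simp: increasing_trees_def rooted_tree_def)
  have D: "pverts (subtree_at t v) = descendants t v"
    using assms by (intro pverts_subtree_at[OF wf]) (simp add: t)
  have A: "parcs (subtree_at t v) = parcs t \<inter> descendants t v \<times> descendants t v"
    using D by (auto simp: subtree_at_def Let_def)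
  have "\<exists>w\<in>{1..n}. w < v" using assms by (auto intro!: bexI[of _ 1])
  then obtain u where u: "(u, v) \<in> parcs t"
    using E assms unfolding increasing_arcs_def by blast
  have p: "parent t v = u" by (rule parent_eq[OF E u])
  have "u \<notin> descendants t v"
    using descendants_ge[OF E, of u v] increasing_arcsD(3)[OF E u] by auto
  have "parcs t - (parcs (subtree_at t v) \<union> {(parent t v, v)}) = parcs t \<inter> V \<times> V"
  proof (intro equalityI subsetI)
    fix e assume e: "e \<in> parcs t - (parcs (subtree_at t v) \<union> {(parent t v, v)})"
    obtain x y where xy: "e = (x, y)" by force
    have "(x, y) \<in> parcs t" using e xy by simp
    note arc = this increasing_arcsD[OF E this]
    have "y \<notin> descendants t v"
    proof
      assume y: "y \<in> descendants t v"
      have "y \<noteq> v" using e xy p u increasing_arcs_parent_unique[OF E] by auto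
      then have "x \<in> descendants t v" using descendants_parent[OF E] arc y by blast
      then show False using e xy y A by auto
    qed
    moreover from this have "x \<notin> descendants t v" using child_in_descendants arc by blast
    ultimately show "e \<in> parcs t \<inter> V \<times> V" using arc xy by (simp add: V_def)
  next
    fix e assume "e \<in> parcs t \<inter> V \<times> V"
    then show "e \<in> parcs t - (parcs (subtree_at t v) \<union> {(parent t v, v)})"
      using A self_in_descendants by (auto simp: V_def)
  qed
  then show ?thesis
    using assms by (simp add: root_part_def t D)
qed

lemma increasing_arcs_root_part:
  assumes "n \<ge> 1" "t \<in> increasing_trees n" "v \<in> {1..n}" "v \<noteq> 1"
  shows "increasing_arcs (pverts (root_part t v)) (parcs (root_part t v))"
proof -
  define V where "V = {1..n} - descendants t v"
  have E: "increasing_arcs {1..n} (parcs t)"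
    using assms by (auto simp: increasing_trees_iff)
  have "\<exists>!u. (u, y) \<in> parcs t \<inter> V \<times> V" if y: "y \<in> V" "\<exists>w\<in>V. w < y" for y
  proof -
    have "y \<in> {1..n}" "\<exists>w\<in>{1..n}. w < y" using y by (auto simp: V_def)
    then obtain u where u: "(u, y) \<in> parcs t" using E unfolding increasing_arcs_def by blast
    then have "u \<in> V"
      using y increasing_arcsD[OF E u] child_in_descendants[OF _ u] by (auto simp: V_def)
    then show ?thesis using u y increasing_arcs_parent_unique[OF E u] by blast
  qed
  then have "increasing_arcs V (parcs t \<inter> V \<times> V)"
    unfolding increasing_arcs_def using increasing_arcsD(3)[OF E] by auto
  then show ?thesis using root_part_eq[OF assms] by (simp add: V_def)
qed

lemma relabel_in_increasing_trees:
  assumes "finite (pverts t)" "pverts t \<noteq> {}" "increasing_arcs (pverts t) (parcs t)"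
  shows "relabel t \<in> increasing_trees (tree_size t)"
proof -
  have "rank_in (pverts t) ` pverts t = {1..card (pverts t)}"
    using bij_betw_rank_in[OF assms(1)] by (simp add: bij_betw_def)
  moreover have "card (pverts t) \<ge> 1" using assms by (simp add: Suc_leI card_gt_0_iff)
  ultimately show ?thesis
    using increasing_arcs_image[OF bij_betw_rank_in rank_in_less_iff assms(3)] assms
    by (simp add: tree_size_def increasing_trees_iff relabel_eq)
qed

text \<open>The second set of arcs contains the arc into \<open>v\<close>, so the subtree at \<open>v\<close> stays attached to the vertex
  of \<open>V\<close> where it was.\<close>

definition graft_root ::
    "nat pair_pre_digraph \<Rightarrow> nat pair_pre_digraph \<Rightarrow> nat \<Rightarrow> nat pair_pre_digraph" where
  "graft_root s t v = (let V = pverts t - descendants t v in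
     \<lparr>pverts = pverts t, parcs = pullback_arcs (rank_in V) V (parcs s) \<union> {(x, y) \<in> parcs t. y \<notin> V}\<rparr>)"

context
  fixes n l t v s V
  assumes n: "n \<ge> 1" and t: "t \<in> increasing_trees n" and v: "v \<in> {1..n}" "v \<noteq> 1"
    and s: "s \<in> increasing_trees l"
  defines "V \<equiv> {1..n} - descendants t v"
  assumes card_V: "card V = l"
begin

lemma pverts_t: "pverts t = {1..n}" and arcs_t: "increasing_arcs {1..n} (parcs t)"
  using t n by (simp_all add: increasing_trees_iff)

lemma parcs_graft_root:
  "parcs (graft_root s t v) = pullback_arcs (rank_in V) V (parcs s) \<union> {(x, y) \<in> parcs t. y \<notin> V}"
  unfolding graft_root_def pverts_t V_def by (simp add: Let_def)

lemma one_in_V: "1 \<in> V"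
  using n v descendants_ge[OF arcs_t, of 1 v] by (auto simp: V_def)

lemma l_pos: "l \<ge> 1"
proof -
  have "card V > 0" using one_in_V by (auto simp: card_gt_0_iff V_def)
  then show ?thesis using card_V by simp
qed

lemma increasing_arcs_pullback_rank_in: "increasing_arcs V (pullback_arcs (rank_in V) V (parcs s))"
proof (rule increasing_arcs_pullback)
  have fin: "finite V" by (simp add: V_def)
  show "bij_betw (rank_in V) V {1..l}" using bij_betw_rank_in[OF fin] card_V by simp
  show "increasing_arcs {1..l} (parcs s)" using s l_pos by (simp add: increasing_trees_iff)
  show "rank_in V a < rank_in V b \<longleftrightarrow> a < b" if "a \<in> V" "b \<in> V" for a b
    using rank_in_less_iff[OF fin that] .
qed

lemma graft_root_in_increasing_trees: "graft_root s t v \<in> increasing_trees n"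
proof -
  note E1 = increasing_arcs_pullback_rank_in
  \<comment> \<open>The parent of a vertex comes from \<open>s\<close> inside \<open>V\<close> and from \<open>t\<close> outside. Inside, \<open>1 \<in> V\<close>
    ensures that a vertex without a parent in the copy of \<open>s\<close> can only be \<open>1\<close>.\<close>
  have "\<exists>!u. (u, y) \<in> parcs (graft_root s t v)" if y: "y \<in> {1..n}" "\<exists>w\<in>{1..n}. w < y" for y
  proof (cases "y \<in> V")
    case True
    moreover have "1 < y" using y by auto
    ultimately have "\<exists>!u. (u, y) \<in> pullback_arcs (rank_in V) V (parcs s)"
      using E1 one_in_V unfolding increasing_arcs_def by blast
    then show ?thesis using True by (auto simp: parcs_graft_root)
  next
    case False
    have "\<exists>!u. (u, y) \<in> parcs t" using y arcs_t unfolding increasing_arcs_def by blast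
    then show ?thesis using False by (auto simp: parcs_graft_root pullback_arcs_def)
  qed
  moreover have "a \<in> {1..n} \<and> b \<in> {1..n} \<and> a < b" if "(a, b) \<in> parcs (graft_root s t v)" for a b
    using that increasing_arcsD[OF E1, of a b] increasing_arcsD[OF arcs_t, of a b]
    by (auto simp: parcs_graft_root V_def)
  ultimately have "increasing_arcs {1..n} (parcs (graft_root s t v))"
    unfolding increasing_arcs_def by blast
  then show ?thesis
    using n by (simp add: increasing_trees_iff graft_root_def pverts_t Let_def)
qed

text \<open>An arc that leaves a descendant of \<open>v\<close> has both endpoints outside \<open>V\<close>, where grafting changes
  nothing.\<close>

lemma descendants_graft_root: "descendants (graft_root s t v) v = descendants t v"
proof (intro equalityI subsetI)
  fix w assume "w \<in> descendants (graft_root s t v) v"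
  then have "(v, w) \<in> (parcs (graft_root s t v))\<^sup>*" by (simp add: descendants_def)
  then show "w \<in> descendants t v"
  proof induction
    case base
    show ?case by (rule self_in_descendants)
  next
    case (step y z)
    then have "y \<notin> V" by (simp add: V_def)
    then have "(y, z) \<in> parcs t" using step by (auto simp: parcs_graft_root pullback_arcs_def)
    then show ?case using step.IH child_in_descendants by blast
  qed
next
  fix w assume "w \<in> descendants t v"
  then have "(v, w) \<in> (parcs t)\<^sup>*" by (simp add: descendants_def)
  then show "w \<in> descendants (graft_root s t v) v"
  proof induction
    case base
    show ?case by (rule self_in_descendants)
  next
    case (step y z)
    then have "z \<in> descendants t v"
      by (simp add: descendants_def rtrancl.rtrancl_into_rtrancl)
    then have "(y, z) \<in> parcs (graft_root s t v)"
      using step by (auto simp: parcs_graft_root V_def)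
    then show ?case using step.IH child_in_descendants by blast
  qed
qed

lemma root_part_graft_root:
  "root_part (graft_root s t v) v = \<lparr>pverts = V, parcs = pullback_arcs (rank_in V) V (parcs s)\<rparr>"
proof -
  have "parcs (graft_root s t v) \<inter> V \<times> V = pullback_arcs (rank_in V) V (parcs s)"
    by (auto simp: parcs_graft_root pullback_arcs_def)
  then show ?thesis
    using root_part_eq[OF n graft_root_in_increasing_trees v]
    unfolding descendants_graft_root V_def[symmetric] by simp
qed

lemma relabel_root_part_graft_root: "relabel (root_part (graft_root s t v) v) = s"
proof -
  have rank_in: "rank_in V ` V = {1..l}"
    using bij_betw_rank_in[of V] card_V by (simp add: bij_betw_def V_def)
  have s': "pverts s = {1..l}" "increasing_arcs {1..l} (parcs s)"
    using s l_pos by (simp_all add: increasing_trees_iff)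
  have "parcs s \<subseteq> rank_in V ` V \<times> rank_in V ` V"
    using increasing_arcsD[OF s'(2)] rank_in by auto
  then show ?thesis
    using s' rank_in by (simp add: relabel_eq root_part_graft_root map_prod_pullback_arcs)
qed

lemma cut_edge_in_graft_root:
  assumes "(v, w) \<in> parcs t"
  shows "(v, w) \<in> parcs (graft_root s t v)"
  using assms child_in_descendants[OF self_in_descendants] by (auto simp: parcs_graft_root V_def)

end

lemma graft_root_relabel_root_part:
  assumes "n \<ge> 1" "t \<in> increasing_trees n" "v \<in> {1..n}" "v \<noteq> 1"
  shows "graft_root (relabel (root_part t v)) t v = t"
proof -
  define V where "V = {1..n} - descendants t v"
  have t: "pverts t = {1..n}" and E: "increasing_arcs {1..n} (parcs t)"
    using assms by (auto simp: increasing_trees_iff)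
  have "inj_on (rank_in V) V"
    using bij_betw_rank_in[of V] by (simp add: V_def bij_betw_def)
  then have "pullback_arcs (rank_in V) V (parcs (relabel (root_part t v))) = parcs t \<inter> V \<times> V"
    using root_part_eq[OF assms, folded V_def] by (simp add: relabel_eq pullback_arcs_map_prod)
  moreover have "parcs t \<inter> V \<times> V \<union> {(x, y) \<in> parcs t. y \<notin> V} = parcs t"
    using increasing_arcsD[OF E] child_in_descendants by (fastforce simp: V_def)
  ultimately have "graft_root (relabel (root_part t v)) t v = \<lparr>pverts = {1..n}, parcs = parcs t\<rparr>"
    unfolding graft_root_def Let_def t V_def[symmetric] by simp
  also have "\<dots> = t" using t by (metis pair_pre_digraph.surjective old.unit.exhaust)
  finally show ?thesis .
qed

text \<open>The second graft overwrites all that the first one changed, so grafting the original root part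
  undoes any graft.\<close>

lemma graft_root_graft_root:
  assumes "n \<ge> 1" "t \<in> increasing_trees n" "v \<in> {1..n}" "v \<noteq> 1"
    and "s \<in> increasing_trees l" "card ({1..n} - descendants t v) = l"
  shows "graft_root s' (graft_root s t v) v = graft_root s' t v"
proof -
  define V where "V = {1..n} - descendants t v"
  have t: "pverts t = {1..n}" using assms by (auto simp: increasing_trees_iff)
  show ?thesis
    using descendants_graft_root[OF assms]
    by (auto simp: graft_root_def t V_def[symmetric] Let_def pullback_arcs_def)
qed

section \<open>The degree-biased cut\<close>

definition cut_trees :: "nat \<Rightarrow> nat \<Rightarrow> (nat pair_pre_digraph \<times> nat \<times> nat) set" where
  "cut_trees n l = {(t, v, w). t \<in> increasing_trees n \<and> (v, w) \<in> parcs t \<and>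
     tree_size (root_part t v) = l}"

abbreviation relabeled_root_part :: "nat pair_pre_digraph \<times> nat \<times> nat \<Rightarrow> nat pair_pre_digraph" where
  "relabeled_root_part \<equiv> \<lambda>(t, v, w). relabel (root_part t v)"

text \<open>The hypothesis \<open>l \<ge> 1\<close> excludes cuts at the root, whose root part is empty.\<close>

lemma cut_treesD:
  assumes "n \<ge> 1" "l \<ge> 1" "(t, v, w) \<in> cut_trees n l"
  shows "t \<in> increasing_trees n" "(v, w) \<in> parcs t" "v \<in> {1..n}" "v \<noteq> 1"
    "card ({1..n} - descendants t v) = l" "relabel (root_part t v) \<in> increasing_trees l"
proof -
  show t: "t \<in> increasing_trees n" and e: "(v, w) \<in> parcs t"
    using assms by (auto simp: cut_trees_def)
  have size: "tree_size (root_part t v) = l" using assms by (simp add: cut_trees_def)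
  then show v1: "v \<noteq> 1" using assms by (auto simp: root_part_def tree_size_def)
  show v: "v \<in> {1..n}"
    using t e assms increasing_arcsD(1) by (metis increasing_trees_iff)
  note root = root_part_eq[OF assms(1) t v v1]
  show "card ({1..n} - descendants t v) = l"
    using size root by (simp add: tree_size_def)
  have "pverts (root_part t v) \<noteq> {}" using size assms by (auto simp: tree_size_def)
  then show "relabel (root_part t v) \<in> increasing_trees l"
    using relabel_in_increasing_trees[OF _ _ increasing_arcs_root_part[OF assms(1) t v v1]]
      size root by simp
qed

lemma finite_cut_trees:
  assumes "n \<ge> 1"
  shows "finite (cut_trees n l)"
proof -
  have "cut_trees n l \<subseteq> increasing_trees n \<times> {1..n} \<times> {1..n}"
    using assms by (fastforce simp: cut_trees_def increasing_trees_iff dest: increasing_arcsD)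
  then show ?thesis
    using finite_increasing_trees by (metis finite_SigmaI finite_atLeastAtMost finite_subset)
qed

text \<open>The injection replaces the root part by a copy of \<open>s'\<close> and leaves the cut edge alone; it is undone by
  grafting \<open>s\<close>.\<close>

lemma card_fibre_le:
  assumes n: "n \<ge> 1" and l: "l \<ge> 1" and s': "s' \<in> increasing_trees l"
  shows "card {x \<in> cut_trees n l. relabeled_root_part x = s} \<le>
    card {x \<in> cut_trees n l. relabeled_root_part x = s'}"
proof (rule card_inj_on_le)
  let ?g = "\<lambda>(t, v, w). (graft_root s' t v, v, w)"
  let ?h = "\<lambda>(t, v, w). (graft_root s t v, v, w)"
  have inv: "?h (?g x) = x" if x: "x \<in> {x \<in> cut_trees n l. relabeled_root_part x = s}" for x
  proof -
    obtain t v w where tvw: "x = (t, v, w)" by (cases x)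
    then have "(t, v, w) \<in> cut_trees n l" and s: "relabel (root_part t v) = s" using x by auto
    note D = cut_treesD[OF n l this(1)]
    show ?thesis
      using graft_root_graft_root[OF n D(1,3,4) s' D(5)] graft_root_relabel_root_part[OF n D(1,3,4)]
      by (simp add: tvw s)
  qed
  then show "inj_on ?g {x \<in> cut_trees n l. relabeled_root_part x = s}"
    by (metis (no_types, lifting) inj_on_inverseI)
  show "?g ` {x \<in> cut_trees n l. relabeled_root_part x = s}
      \<subseteq> {x \<in> cut_trees n l. relabeled_root_part x = s'}"
  proof (rule image_subsetI)
    fix x assume x: "x \<in> {x \<in> cut_trees n l. relabeled_root_part x = s}"
    obtain t v w where tvw: "x = (t, v, w)" by (cases x)
    then have "(t, v, w) \<in> cut_trees n l" using x by auto
    note D = cut_treesD[OF n l this]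
    note ctx = n D(1,3,4) s' D(5)
    have "tree_size (root_part (graft_root s' t v) v) = l"
      using D(5) by (simp add: root_part_graft_root[OF ctx] tree_size_def)
    then show "?g x \<in> {x \<in> cut_trees n l. relabeled_root_part x = s'}"
      using graft_root_in_increasing_trees[OF ctx] cut_edge_in_graft_root[OF ctx D(2)]
        relabel_root_part_graft_root[OF ctx]
      by (simp add: tvw cut_trees_def)
  qed
  show "finite {x \<in> cut_trees n l. relabeled_root_part x = s'}"
    using finite_cut_trees[OF n] by simp
qed

text \<open>The path \<open>1, 2, \<dots>, n\<close> cut at its edge from \<open>l + 1\<close> to \<open>l + 2\<close> leaves the root part \<open>1, \<dots>, l\<close>.\<close>

lemma cut_trees_nonempty:
  assumes "l \<ge> 1" "l + 2 \<le> n"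
  shows "cut_trees n l \<noteq> {}"
proof -
  define E where "E = {(i, j). i \<in> {1..n} \<and> j \<in> {1..n} \<and> j = Suc i}"
  define t where "t = \<lparr>pverts = {1..n}, parcs = E\<rparr>"
  have E: "increasing_arcs {1..n} E"
    unfolding increasing_arcs_def
  proof (intro conjI ballI impI)
    fix y assume "y \<in> {1..n}" "\<exists>w\<in>{1..n}. w < y"
    then have "(y - 1, y) \<in> E" "\<And>u. (u, y) \<in> E \<Longrightarrow> u = y - 1" by (auto simp: E_def)
    then show "\<exists>!u. (u, y) \<in> E" by blast
  qed (auto simp: E_def)
  then have t: "t \<in> increasing_trees n"
    using assms by (simp add: t_def increasing_trees_iff)
  have desc: "descendants t (Suc l) = {Suc l..n}"
  proof (intro equalityI subsetI)
    fix w assume "w \<in> descendants t (Suc l)"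
    then have "(Suc l, w) \<in> E\<^sup>*" by (simp add: descendants_def t_def)
    then show "w \<in> {Suc l..n}" by induction (use assms in \<open>auto simp: E_def\<close>)
  next
    fix w assume w: "w \<in> {Suc l..n}"
    then have "Suc l \<le> w" by simp
    then have "w \<le> n \<longrightarrow> w \<in> descendants t (Suc l)"
    proof (induction w rule: dec_induct)
      case (step m)
      have "Suc m \<le> n \<Longrightarrow> (m, Suc m) \<in> parcs t" using step by (auto simp: t_def E_def)
      then show ?case using step.IH child_in_descendants[of m t] by (auto dest: Suc_leD)
    qed (simp add: self_in_descendants)
    then show "w \<in> descendants t (Suc l)" using w by simp
  qed
  have "{1..n} - {Suc l..n} = {1..l}" using assms by auto
  then have "tree_size (root_part t (Suc l)) = l"
    using root_part_eq[OF _ t, of "Suc l"] assms by (simp add: desc tree_size_def)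
  moreover have "(Suc l, Suc (Suc l)) \<in> parcs t" using assms by (auto simp: t_def E_def)
  ultimately have "(t, Suc l, Suc (Suc l)) \<in> cut_trees n l" using t by (simp add: cut_trees_def)
  then show ?thesis by blast
qed

lemma random_root_tree_eq:
  assumes "n \<ge> 2"
  shows "random_root_tree n =
    map_pmf (\<lambda>(t, v, w). root_part t v) (pmf_of_set (Sigma (increasing_trees n) parcs))"
proof -
  have "random_root_tree n = bind_pmf (pmf_of_set (increasing_trees n))
      (\<lambda>t. map_pmf ((\<lambda>t (v, w). root_part t v) t) (pmf_of_set (parcs t)))"
    unfolding random_root_tree_def random_recursive_tree_def degree_biased_cut_def by simp
  also have "\<dots> = map_pmf (\<lambda>(t, e). (\<lambda>t (v, w). root_part t v) t e)
      (pmf_of_set (Sigma (increasing_trees n) parcs))"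
  proof (rule bind_pmf_of_set_Sigma)
    show "card (parcs t) = n - 1" if "t \<in> increasing_trees n" for t
      using card_parcs_increasing_tree[OF _ that] assms by simp
  qed (use assms finite_increasing_trees increasing_trees_nonempty in auto)
  finally show ?thesis by simp
qed

theorem proposition1p2:
  fixes n l :: nat
  assumes "n \<ge> 2" and "l \<in> {1..n - 2}"
  shows "measure_pmf.prob (random_root_tree n) {t. tree_size t = l} > 0 \<and>
    map_pmf relabel (cond_pmf (random_root_tree n) {t. tree_size t = l}) = random_recursive_tree l"
proof
  let ?A = "{t. tree_size t = l}"
  let ?S = "Sigma (increasing_trees n) parcs"
  let ?f = "\<lambda>(t, v, w). root_part t v"
  have n: "n \<ge> 1" and l: "l \<ge> 1" and l2: "l + 2 \<le> n" using assms by auto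
  obtain s\<^sub>0 where s\<^sub>0: "s\<^sub>0 \<in> increasing_trees l"
    using increasing_trees_nonempty[OF l] by blast
  have cut: "?S \<inter> ?f -` ?A = cut_trees n l" by (auto simp: cut_trees_def)
  have ne: "cut_trees n l \<noteq> {}" using cut_trees_nonempty[OF l l2] .
  have "finite (parcs t)" if "t \<in> increasing_trees n" for t
    using card_parcs_increasing_tree[OF n that] assms card_ge_0_finite by force
  then have fin: "finite ?S" using finite_increasing_trees by blast
  have "?S \<noteq> {}" using cut ne by auto
  then have set: "set_pmf (pmf_of_set ?S) \<inter> ?f -` ?A \<noteq> {}" using fin ne cut by simp
  then have "set_pmf (random_root_tree n) \<inter> ?A \<noteq> {}"
    unfolding random_root_tree_eq[OF assms(1)] by auto
  then show "measure_pmf.prob (random_root_tree n) ?A > 0"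
    by (simp add: measure_measure_pmf_not_zero zero_less_measure_iff)
  have "cond_pmf (random_root_tree n) ?A = map_pmf ?f (cond_pmf (pmf_of_set ?S) (?f -` ?A))"
    unfolding random_root_tree_eq[OF assms(1)] by (rule cond_map_pmf[OF set])
  also have "\<dots> = map_pmf ?f (pmf_of_set (cut_trees n l))"
    using cond_pmf_of_set[OF fin, of "?f -` ?A"] ne cut by simp
  finally have "map_pmf relabel (cond_pmf (random_root_tree n) ?A) =
      map_pmf relabeled_root_part (pmf_of_set (cut_trees n l))"
    by (simp add: pmf.map_comp o_def case_prod_unfold)
  also have "\<dots> = pmf_of_set (increasing_trees l)"
  proof (rule map_pmf_of_set_equal_fibres)
    show "card {x \<in> cut_trees n l. relabeled_root_part x = s} =
        card {x \<in> cut_trees n l. relabeled_root_part x = s\<^sub>0}"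
      if "s \<in> increasing_trees l" for s
      using card_fibre_le[OF n l] that s\<^sub>0 by (simp add: antisym)
    show "relabeled_root_part ` cut_trees n l \<subseteq> increasing_trees l"
      using cut_treesD(6)[OF n l] by auto
  qed (use finite_cut_trees[OF n] ne finite_increasing_trees in auto)
  finally show "map_pmf relabel (cond_pmf (random_root_tree n) ?A) = random_recursive_tree l"
    by (simp add: random_recursive_tree_def)
qed

end
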